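(* Let $p:\mathbb{R}^d\to[1,\infty)$ be a bounded measurable function. The following conditions are equivalent. (i) There exists a constant $C_{\gamma_d}>0$ such that $p_B^+-p_B^-\le \frac{C_{\gamma_d}}{|q_B|^2}$ for every ball $B$ of $\mathbb{R}^d$ (no condition being imposed when $q_B=0$). (ii) There exist constants $p_\infty\in[1,\infty)$ and $C_{\gamma_d}>0$ such that $|p(x)-p_\infty|\le\frac{C_{\gamma_d}}{|x|^2}$ for all $x\in\mathbb{R}^d\setminus\{0\}$. (iii) There exists a constant $\widetilde{C_{\gamma_d}}>0$ such that $|p(x)-p(y)|\le\frac{\widetilde{C_{\gamma_d}}}{|x|^2}$ for all $x,y\in\mathbb{R}^d$ with $x\neq 0$ and $|y|\ge|x|$.
   Context: For a ball $B$ of $\mathbb{R}^d$, $q_B$ denotes the point of the closure $\overline B$ whose distance to the origin is minimal, so $|q_B|=\mathrm{dist}(0,B)$. $p_B^-$ and $p_B^+$ denote the essential infimum and essential supremum of $p$ on $B$ (with respect to the Gaussian measure $d\gamma_d(x)=\pi^{-d/2}e^{-|x|^2}dx$, equivalently Lebesgue measure).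
   Formalization: As stated, (i) does not imply (ii) or (iii): it fails for d = 1 and for changes of p on null sets. Proved: (ii)⇔(iii) and (ii)⇒(i) for all d; for d ≥ 2, (i) holds iff some bounded measurable q ≥ 1 equal to p almost everywhere satisfies (ii), equivalently (iii). *)

theory Defs
  imports "HOL-Probability.Essential_Supremum"
begin

(* The density is taken over lebesgue rather than lborel, so that "measurable" means
   Lebesgue measurable throughout. *)
definition gauss_measure :: "(real ^ 'd) measure" where
  "gauss_measure =
     density lebesgue (\<lambda>x. ennreal (pi powr (- real CARD('d) / 2) * exp (- (norm x)\<^sup>2)))"

definition essinf :: "'a measure \<Rightarrow> ('a \<Rightarrow> ereal) \<Rightarrow> ereal" where
  "essinf M f = - esssup M (\<lambda>x. - f x)"

definition ess_sup_on :: "(real ^ 'd) set \<Rightarrow> (real ^ 'd \<Rightarrow> real) \<Rightarrow> ereal" where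
  "ess_sup_on B p = esssup (restrict_space gauss_measure B) (\<lambda>x. ereal (p x))"

definition ess_inf_on :: "(real ^ 'd) set \<Rightarrow> (real ^ 'd \<Rightarrow> real) \<Rightarrow> ereal" where
  "ess_inf_on B p = essinf (restrict_space gauss_measure B) (\<lambda>x. ereal (p x))"

definition nearest_to_origin :: "(real ^ 'd) set \<Rightarrow> real ^ 'd" where
  "nearest_to_origin B = closest_point (closure B) 0"

definition bounded_exponent :: "(real ^ 'd \<Rightarrow> real) \<Rightarrow> bool" where
  "bounded_exponent p \<longleftrightarrow>
     p \<in> borel_measurable lebesgue \<and> (\<forall>x. 1 \<le> p x) \<and> bounded (range p)"

definition ball_oscillation_decay :: "(real ^ 'd \<Rightarrow> real) \<Rightarrow> bool" where
  "ball_oscillation_decay p \<longleftrightarrow>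
     (\<exists>C>0. \<forall>c r. 0 < r \<longrightarrow> nearest_to_origin (ball c r) \<noteq> 0 \<longrightarrow>
        ess_sup_on (ball c r) p - ess_inf_on (ball c r) p
          \<le> ereal (C / (norm (nearest_to_origin (ball c r)))\<^sup>2))"

definition decay_to_limit :: "(real ^ 'd \<Rightarrow> real) \<Rightarrow> bool" where
  "decay_to_limit p \<longleftrightarrow>
     (\<exists>p_inf\<ge>1. \<exists>C>0. \<forall>x. x \<noteq> 0 \<longrightarrow> \<bar>p x - p_inf\<bar> \<le> C / (norm x)\<^sup>2)"

definition pairwise_decay :: "(real ^ 'd \<Rightarrow> real) \<Rightarrow> bool" where
  "pairwise_decay p \<longleftrightarrow>
     (\<exists>C>0. \<forall>x y. x \<noteq> 0 \<longrightarrow> norm x \<le> norm y \<longrightarrow> \<bar>p x - p y\<bar> \<le> C / (norm x)\<^sup>2)"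

(* The ball condition only sees the almost-everywhere class of p, while the other two
   conditions are pointwise; this relation identifies exponents that agree almost everywhere. *)
definition is_version_of :: "(real ^ 'd \<Rightarrow> real) \<Rightarrow> (real ^ 'd \<Rightarrow> real) \<Rightarrow> bool" where
  "is_version_of q p \<longleftrightarrow> bounded_exponent q \<and> (AE x in lebesgue. q x = p x)"

end

theory Submission
  imports Defs
begin

text \<open>A pairwise bound \<open>C / (norm x)\<^sup>2\<close> is a Cauchy condition at infinity, so it is equivalent to
  convergence to a limit at the same rate (\<open>limit_of_pairwise_decay_off\<close>). A limit at this rate
  controls the oscillation on every ball, because all points of a ball are at least as far from the
  origin as its nearest point.

  The converse for balls is the substantial part. A half-space at distance \<open>t > 0\<close> from the
  origin is an increasing union of balls at the same distance \<open>t\<close>, so the ball condition, whose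
  bound depends on the distance alone, bounds the essential oscillation on the half-space by
  \<open>C / t\<^sup>2\<close> (\<open>ess_osc_le_halfspace\<close>). The half-spaces at distance \<open>t\<close> in the directions
  \<open>\<plusminus>b\<close>, for \<open>b\<close> in the standard basis, cover the complement of a ball whose radius is a multiple
  of \<open>t\<close>. In dimension at least two any two of them are joined by a chain of at most three whose
  consecutive members overlap in positive measure, so the essential oscillation on that complement
  is at most \<open>3 * C / t\<^sup>2\<close> (\<open>ess_osc_le_exterior\<close>). Letting \<open>t\<close> range over the positive rationals
  gives the pairwise bound outside one null set. The limit \<open>l\<close> exists as before, and overwriting
  \<open>p\<close> by \<open>l\<close> on the null set is the required version.\<close>

section \<open>Essential oscillation\<close>

text \<open>The formulation by pairs outside a null set, rather than by a difference of essential bounds,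
  makes it easy to combine sets: exceptional sets of countably many bounds can be united, and bounds
  on two sets add up by the triangle inequality at any common point that is not exceptional.\<close>

definition ess_osc_le :: "('a::euclidean_space \<Rightarrow> real) \<Rightarrow> 'a set \<Rightarrow> real \<Rightarrow> bool" where
  "ess_osc_le p A e \<longleftrightarrow>
     (\<exists>N. negligible N \<and> (\<forall>x\<in>A - N. \<forall>y\<in>A - N. \<bar>p x - p y\<bar> \<le> e))"

lemma AE_lebesgue_iff_negligible:
  "(AE x in lebesgue. P x) \<longleftrightarrow> (\<exists>N. negligible N \<and> (\<forall>x. x \<notin> N \<longrightarrow> P x))"
proof
  assume "AE x in lebesgue. P x"
  then obtain N where "N \<in> null_sets lebesgue" "{x \<in> space lebesgue. \<not> P x} \<subseteq> N"
    by (rule AE_E3) (auto simp: subset_iff)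
  then show "\<exists>N. negligible N \<and> (\<forall>x. x \<notin> N \<longrightarrow> P x)"
    by (auto simp: negligible_iff_null_sets)
next
  assume "\<exists>N. negligible N \<and> (\<forall>x. x \<notin> N \<longrightarrow> P x)"
  then show "AE x in lebesgue. P x"
    by (auto simp: negligible_iff_null_sets intro!: AE_I')
qed

lemma gauss_density_measurable:
  "(\<lambda>x::real^'d. ennreal (pi powr (- real CARD('d) / 2) * exp (- (norm x)\<^sup>2)))
     \<in> borel_measurable lebesgue"
proof -
  have "(\<lambda>x::real^'d. ennreal (pi powr (- real CARD('d) / 2) * exp (- (norm x)\<^sup>2)))
     \<in> borel_measurable borel" by measurable
  then show ?thesis by (intro measurable_completion) simp
qed

text \<open>The Gaussian density is strictly positive, so the Gaussian measure and Lebesgue measure have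
  the same null sets.\<close>

lemma AE_restrict_gauss_iff:
  fixes B :: "(real^'d) set"
  assumes "B \<in> sets lebesgue"
  shows "(AE x in restrict_space gauss_measure B. P x) \<longleftrightarrow> (AE x in lebesgue. x \<in> B \<longrightarrow> P x)"
proof -
  have "B \<inter> space gauss_measure \<in> sets gauss_measure"
    using assms by (simp add: gauss_measure_def)
  then have "(AE x in restrict_space gauss_measure B. P x) \<longleftrightarrow>
      (AE x in gauss_measure. x \<in> B \<longrightarrow> P x)"
    by (rule AE_restrict_space_iff)
  also have "\<dots> \<longleftrightarrow> (AE x in lebesgue. x \<in> B \<longrightarrow> P x)"
    unfolding gauss_measure_def AE_density[OF gauss_density_measurable] by simp
  finally show ?thesis .
qed

lemma ess_osc_le_of_ess_sup_inf:
  fixes p :: "real^'d \<Rightarrow> real"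
  assumes B: "B \<in> sets lebesgue"
    and le: "ess_sup_on B p - ess_inf_on B p \<le> ereal e"
  shows "ess_osc_le p B e"
proof -
  have "AE x in lebesgue. x \<in> B \<longrightarrow> ereal (p x) \<le> ess_sup_on B p"
    unfolding AE_restrict_gauss_iff[OF B, symmetric] ess_sup_on_def by (rule esssup_AE)
  moreover have "AE x in lebesgue. x \<in> B \<longrightarrow> - ereal (p x) \<le> - ess_inf_on B p"
    unfolding AE_restrict_gauss_iff[OF B, symmetric] ess_inf_on_def essinf_def ereal_uminus_uminus
    by (rule esssup_AE)
  ultimately have "AE x in lebesgue. x \<in> B \<longrightarrow>
      ereal (p x) \<le> ess_sup_on B p \<and> ess_inf_on B p \<le> ereal (p x)"
    unfolding ereal_minus_le_minus by eventually_elim blast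
  then obtain N where N: "negligible N" and bounds: "\<And>x. x \<in> B - N \<Longrightarrow>
      ereal (p x) \<le> ess_sup_on B p \<and> ess_inf_on B p \<le> ereal (p x)"
    unfolding AE_lebesgue_iff_negligible by blast
  have one_sided: "p x - p y \<le> e" if "x \<in> B - N" "y \<in> B - N" for x y
  proof -
    have "ereal (p x) - ereal (p y) \<le> ess_sup_on B p - ess_inf_on B p"
      using bounds that by (intro ereal_minus_mono) auto
    with le have "ereal (p x) - ereal (p y) \<le> ereal e" by (rule order_trans[rotated])
    then show ?thesis by simp
  qed
  have "\<bar>p x - p y\<bar> \<le> e" if "x \<in> B - N" "y \<in> B - N" for x y
    using one_sided[of x y] one_sided[of y x] that by auto
  with N show ?thesis unfolding ess_osc_le_def by blast
qed

lemma ess_sup_inf_le_of_AE_near: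
  fixes p :: "real^'d \<Rightarrow> real"
  assumes B: "B \<in> sets lebesgue" and p: "p \<in> borel_measurable lebesgue"
    and near: "AE x in lebesgue. x \<in> B \<longrightarrow> \<bar>p x - l\<bar> \<le> e"
  shows "ess_sup_on B p - ess_inf_on B p \<le> ereal (2 * e)"
proof -
  have [measurable]: "p \<in> borel_measurable (restrict_space gauss_measure B)"
    using p by (intro measurable_restrict_space1) (simp add: gauss_measure_def)
  have "ess_sup_on B p \<le> ereal (l + e)"
    unfolding ess_sup_on_def
  proof (rule esssup_I)
    show "AE x in restrict_space gauss_measure B. ereal (p x) \<le> ereal (l + e)"
      unfolding AE_restrict_gauss_iff[OF B] using near by eventually_elim auto
  qed measurable
  moreover have "- ess_inf_on B p \<le> ereal (e - l)"
    unfolding ess_inf_on_def essinf_def ereal_uminus_uminus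
  proof (rule esssup_I)
    show "AE x in restrict_space gauss_measure B. - ereal (p x) \<le> ereal (e - l)"
      unfolding AE_restrict_gauss_iff[OF B] using near by eventually_elim auto
  qed measurable
  ultimately have "ess_sup_on B p + - ess_inf_on B p \<le> ereal (l + e) + ereal (e - l)"
    by (rule add_mono)
  then show ?thesis by (simp add: minus_ereal_def)
qed

section \<open>Decay off a null set\<close>

text \<open>Both a genuine pairwise bound (with empty \<open>N\<close>) and one that holds almost everywhere
  produce a limit: a null set cannot contain the complement of a ball, so there are points
  \<open>y n\<close> outside \<open>N\<close> that tend to infinity, the bounded values \<open>p (y n)\<close> have a cluster point
  \<open>l\<close>, and the bound between \<open>x\<close> and \<open>y n\<close> passes to the limit.\<close>

lemma limit_of_pairwise_decay_off:
  fixes p :: "'a::euclidean_space \<Rightarrow> real"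
  assumes N: "negligible N" and bdd: "bounded (range p)" and p_ge: "\<And>x. m \<le> p x"
    and pair: "\<And>x y. x \<notin> N \<Longrightarrow> y \<notin> N \<Longrightarrow> x \<noteq> 0 \<Longrightarrow> norm x \<le> norm y \<Longrightarrow>
                 \<bar>p x - p y\<bar> \<le> C / (norm x)\<^sup>2"
  obtains l where "m \<le> l" "\<And>x. x \<notin> N \<Longrightarrow> x \<noteq> 0 \<Longrightarrow> \<bar>p x - l\<bar> \<le> C / (norm x)\<^sup>2"
proof -
  have "\<exists>y. y \<notin> N \<and> real n \<le> norm y" for n
  proof (rule ccontr)
    assume "\<not> ?thesis"
    then have "- cball (0::'a) (real n) \<subseteq> N" by fastforce
    with N have "negligible (- cball (0::'a) (real n))" by (rule negligible_subset)
    then have "- cball (0::'a) (real n) = {}"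
      by (metis closed_cball open_Compl open_not_negligible)
    moreover have "\<exists>z::'a. real n < norm z"
      using vector_choose_size[of "real n + 1"] by (metis less_add_one of_nat_0_le_iff add_nonneg_nonneg zero_le_one)
    ultimately show False by (auto simp: set_eq_iff not_le)
  qed
  then obtain y where y: "\<And>n. y n \<notin> N" "\<And>n. real n \<le> norm (y n)" by metis
  have "bounded (range (\<lambda>n. p (y n)))"
    by (rule bounded_subset[OF bdd]) auto
  then obtain l r where r: "strict_mono r" and lim: "((\<lambda>n. p (y n)) \<circ> r) \<longlonglongrightarrow> l"
    using bounded_imp_convergent_subsequence by blast
  have lim': "(\<lambda>n. p (y (r n))) \<longlonglongrightarrow> l" using lim by (simp add: o_def)
  show thesis
  proof
    show "m \<le> l" by (rule LIMSEQ_le_const[OF lim']) (use p_ge in auto)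
    fix x assume x: "x \<notin> N" "x \<noteq> 0"
    obtain K where K: "norm x \<le> real K" using real_arch_simple by blast
    have "norm x \<le> norm (y (r n))" if "K \<le> n" for n
      using K y(2)[of "r n"] seq_suble[OF r, of n] that by linarith
    then have "\<exists>K. \<forall>n\<ge>K. \<bar>p x - p (y (r n))\<bar> \<le> C / (norm x)\<^sup>2"
      using pair x y(1) by blast
    moreover have "(\<lambda>n. \<bar>p x - p (y (r n))\<bar>) \<longlonglongrightarrow> \<bar>p x - l\<bar>"
      by (intro tendsto_intros lim')
    ultimately show "\<bar>p x - l\<bar> \<le> C / (norm x)\<^sup>2" by (meson LIMSEQ_le_const2)
  qed
qed

lemma pairwise_decay_of_decay_to_limit:
  assumes "decay_to_limit p"
  shows "pairwise_decay p"
proof -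
  obtain l C where C: "C > 0" and l: "\<And>x. x \<noteq> 0 \<Longrightarrow> \<bar>p x - l\<bar> \<le> C / (norm x)\<^sup>2"
    using assms unfolding decay_to_limit_def by blast
  have "\<bar>p x - p y\<bar> \<le> (2 * C) / (norm x)\<^sup>2" if "x \<noteq> 0" "norm x \<le> norm y" for x y
  proof -
    have "y \<noteq> 0" using that by auto
    have "C / (norm y)\<^sup>2 \<le> C / (norm x)\<^sup>2"
      using that C by (intro divide_left_mono power_mono mult_pos_pos) auto
    with l[OF \<open>x \<noteq> 0\<close>] l[OF \<open>y \<noteq> 0\<close>] show ?thesis by auto
  qed
  with C show ?thesis unfolding pairwise_decay_def by (intro exI[of _ "2 * C"]) auto
qed

lemma decay_to_limit_iff_pairwise_decay:
  fixes p :: "real^'d \<Rightarrow> real"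
  assumes "bounded_exponent p"
  shows "decay_to_limit p \<longleftrightarrow> pairwise_decay p"
proof
  assume "pairwise_decay p"
  then obtain C where C: "C > 0"
    and pair: "\<And>x y. x \<noteq> 0 \<Longrightarrow> norm x \<le> norm y \<Longrightarrow> \<bar>p x - p y\<bar> \<le> C / (norm x)\<^sup>2"
    unfolding pairwise_decay_def by blast
  obtain l where "1 \<le> l" "\<And>x. x \<noteq> 0 \<Longrightarrow> \<bar>p x - l\<bar> \<le> C / (norm x)\<^sup>2"
    by (rule limit_of_pairwise_decay_off[of "{}" p 1 C])
      (use assms pair in \<open>auto simp: bounded_exponent_def\<close>)
  with C show "decay_to_limit p" unfolding decay_to_limit_def by blast
qed (rule pairwise_decay_of_decay_to_limit)

section \<open>From decay to balls\<close>

lemma ball_oscillation_decay_of_decay_version: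
  fixes p q :: "real^'d \<Rightarrow> real"
  assumes p: "p \<in> borel_measurable lebesgue"
    and q: "decay_to_limit q" and eq: "AE x in lebesgue. q x = p x"
  shows "ball_oscillation_decay p"
proof -
  obtain l C where C: "C > 0" and l: "\<And>x. x \<noteq> 0 \<Longrightarrow> \<bar>q x - l\<bar> \<le> C / (norm x)\<^sup>2"
    using q unfolding decay_to_limit_def by blast
  have "ess_sup_on (ball c r) p - ess_inf_on (ball c r) p
          \<le> ereal ((2 * C) / (norm (nearest_to_origin (ball c r)))\<^sup>2)"
    if nz: "nearest_to_origin (ball c r) \<noteq> 0" for c r
  proof -
    let ?s = "norm (nearest_to_origin (ball c r))"
    have near: "\<bar>q x - l\<bar> \<le> C / ?s\<^sup>2" if "x \<in> ball c r" for x
    proof -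
      have "x \<in> closure (ball c r)" using that closure_subset by blast
      then have le: "?s \<le> norm x"
        using closest_point_le[of "closure (ball c r)" x 0] by (simp add: nearest_to_origin_def)
      then have "x \<noteq> 0" using nz by auto
      have "C / (norm x)\<^sup>2 \<le> C / ?s\<^sup>2"
        using le nz C \<open>x \<noteq> 0\<close> by (intro divide_left_mono power_mono mult_pos_pos) auto
      with l[OF \<open>x \<noteq> 0\<close>] show ?thesis by linarith
    qed
    have "AE x in lebesgue. x \<in> ball c r \<longrightarrow> \<bar>p x - l\<bar> \<le> C / ?s\<^sup>2"
      using eq by eventually_elim (metis near)
    then have "ess_sup_on (ball c r) p - ess_inf_on (ball c r) p \<le> ereal (2 * (C / ?s\<^sup>2))"
      using p by (intro ess_sup_inf_le_of_AE_near) auto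
    then show ?thesis by simp
  qed
  with C show ?thesis
    unfolding ball_oscillation_decay_def by (intro exI[of _ "2 * C"]) auto
qed

section \<open>From balls to half-spaces\<close>

text \<open>The open half-space is the increasing union of the balls of radius \<open>n\<close> that touch its
  boundary at the point \<open>t *\<^sub>R u\<close> closest to the origin.\<close>

lemma halfspace_eventually_in_tangent_ball:
  fixes u x :: "'a::real_inner"
  assumes u: "norm u = 1" and x: "t < u \<bullet> x"
  shows "\<exists>K. \<forall>n\<ge>K. x \<in> ball ((t + real n) *\<^sub>R u) (real n)"
proof -
  obtain K where K: "((norm x)\<^sup>2 + t\<^sup>2 - 2 * t * (u \<bullet> x)) / (2 * (u \<bullet> x - t)) < real K"
    using reals_Archimedean2 by blast
  have "x \<in> ball ((t + real n) *\<^sub>R u) (real n)" if "K \<le> n" for n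
  proof -
    have "((norm x)\<^sup>2 + t\<^sup>2 - 2 * t * (u \<bullet> x)) / (2 * (u \<bullet> x - t)) < real n"
      using K that by linarith
    then have "(norm x)\<^sup>2 + t\<^sup>2 - 2 * t * (u \<bullet> x) < real n * (2 * (u \<bullet> x - t))"
      using x by (simp add: pos_divide_less_eq)
    moreover have "(norm ((t + real n) *\<^sub>R u - x))\<^sup>2 =
        (t + real n)\<^sup>2 - 2 * (t + real n) * (u \<bullet> x) + (norm x)\<^sup>2"
    proof -
      have "(norm (a *\<^sub>R u - x))\<^sup>2 = a\<^sup>2 - 2 * a * (u \<bullet> x) + (norm x)\<^sup>2" for a
        using u unfolding power2_norm_eq_inner norm_eq_1
        by (simp add: inner_diff_left inner_diff_right inner_commute[of x u] power2_eq_square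
              right_diff_distrib)
      then show ?thesis .
    qed
    ultimately have "(norm ((t + real n) *\<^sub>R u - x))\<^sup>2 < (real n)\<^sup>2"
      by (simp add: power2_eq_square algebra_simps)
    then have "norm ((t + real n) *\<^sub>R u - x) < real n"
      by (rule power2_less_imp_less) simp
    then show ?thesis by (simp add: dist_norm)
  qed
  then show ?thesis by blast
qed

text \<open>The tangent ball lies in the half-space \<open>u \<bullet> x \<ge> t\<close>, on which the norm is at least \<open>t\<close>.\<close>

lemma norm_nearest_to_origin_tangent_ball:
  fixes u :: "real^'d"
  assumes u: "norm u = 1" and r: "0 < r"
  shows "t \<le> norm (nearest_to_origin (ball ((t + r) *\<^sub>R u) r))"
proof -
  let ?q = "nearest_to_origin (ball ((t + r) *\<^sub>R u) r)"
  have "?q \<in> cball ((t + r) *\<^sub>R u) r"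
    using r closest_point_in_set[of "cball ((t + r) *\<^sub>R u) r" 0]
    by (simp add: nearest_to_origin_def)
  then have "norm ((t + r) *\<^sub>R u - ?q) \<le> r" by (simp add: dist_norm)
  moreover have "u \<bullet> ((t + r) *\<^sub>R u - ?q) \<le> norm ((t + r) *\<^sub>R u - ?q)"
    using norm_cauchy_schwarz[of u "(t + r) *\<^sub>R u - ?q"] u by simp
  moreover have "u \<bullet> ((t + r) *\<^sub>R u - ?q) = t + r - u \<bullet> ?q"
    using u by (simp add: inner_diff_right norm_eq_1)
  moreover have "u \<bullet> ?q \<le> norm ?q"
    using norm_cauchy_schwarz[of u ?q] u by simp
  ultimately show ?thesis by linarith
qed

lemma ess_osc_le_halfspace:
  fixes p :: "real^'d \<Rightarrow> real"
  assumes C: "0 < C"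
    and osc: "\<And>c r. 0 < r \<Longrightarrow> nearest_to_origin (ball c r) \<noteq> 0 \<Longrightarrow>
        ess_sup_on (ball c r) p - ess_inf_on (ball c r) p
          \<le> ereal (C / (norm (nearest_to_origin (ball c r)))\<^sup>2)"
    and u: "norm u = 1" and t: "0 < t"
  shows "ess_osc_le p {x. t < u \<bullet> x} (C / t\<^sup>2)"
proof -
  define B where "B n = ball ((t + real n) *\<^sub>R u) (real n)" for n
  have "\<exists>N. negligible N \<and> (\<forall>x\<in>B n - N. \<forall>y\<in>B n - N. \<bar>p x - p y\<bar> \<le> C / t\<^sup>2)" for n
  proof (cases "n = 0")
    case True
    then show ?thesis by (intro exI[of _ "{}"]) (simp add: B_def)
  next
    case False
    have tq: "t \<le> norm (nearest_to_origin (B n))"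
      using norm_nearest_to_origin_tangent_ball[OF u, of "real n" t] False by (simp add: B_def)
    with t have "nearest_to_origin (B n) \<noteq> 0" by auto
    with osc False have "ess_sup_on (B n) p - ess_inf_on (B n) p
        \<le> ereal (C / (norm (nearest_to_origin (B n)))\<^sup>2)"
      by (simp add: B_def)
    also have "\<dots> \<le> ereal (C / t\<^sup>2)"
      unfolding ereal_less_eq using tq t C
      by (intro divide_left_mono power_mono mult_pos_pos zero_less_power) auto
    finally have "ess_osc_le p (B n) (C / t\<^sup>2)"
      by (intro ess_osc_le_of_ess_sup_inf) (simp_all add: B_def)
    then show ?thesis by (simp add: ess_osc_le_def)
  qed
  then obtain N where N: "\<And>n. negligible (N n)"
    "\<And>n x y. x \<in> B n - N n \<Longrightarrow> y \<in> B n - N n \<Longrightarrow> \<bar>p x - p y\<bar> \<le> C / t\<^sup>2"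
    by metis
  have "negligible (\<Union>n. N n)" using N(1) by auto
  moreover have "\<bar>p x - p y\<bar> \<le> C / t\<^sup>2"
    if "x \<in> {x. t < u \<bullet> x} - (\<Union>n. N n)" "y \<in> {x. t < u \<bullet> x} - (\<Union>n. N n)" for x y
  proof -
    have "\<exists>K. \<forall>n\<ge>K. x \<in> B n" "\<exists>L. \<forall>n\<ge>L. y \<in> B n"
      unfolding B_def using that by (intro halfspace_eventually_in_tangent_ball[OF u]; simp)+
    then obtain K L where "\<forall>n\<ge>K. x \<in> B n" "\<forall>n\<ge>L. y \<in> B n" by blast
    then have "x \<in> B (max K L)" "y \<in> B (max K L)" by auto
    with that show ?thesis by (intro N(2)) auto
  qed
  ultimately show ?thesis unfolding ess_osc_le_def by blast
qed

section \<open>From half-spaces to the exterior of a ball\<close>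

text \<open>The ray through \<open>u + v\<close> eventually enters both half-spaces, since
  \<open>u \<bullet> (u + v) = v \<bullet> (u + v) = 1 + u \<bullet> v\<close>, which is positive for non-antipodal unit vectors.\<close>

lemma not_negligible_Int_halfspaces:
  fixes u v :: "'a::euclidean_space"
  assumes u: "norm u = 1" and v: "norm v = 1" and "v \<noteq> - u"
  shows "\<not> negligible ({x. t < u \<bullet> x} \<inter> {x. t < v \<bullet> x})"
proof (rule open_not_negligible)
  show "open ({x. t < u \<bullet> x} \<inter> {x. t < v \<bullet> x})"
    by (intro open_Int open_halfspace_gt)
  have "u + v \<noteq> 0" using assms(3) by (metis add_eq_0_iff)
  then have "0 < (u + v) \<bullet> (u + v)" by simp
  then have pos: "0 < 1 + u \<bullet> v"
    using u v by (simp add: inner_add_left inner_add_right inner_commute norm_eq_1)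
  define s where "s = (\<bar>t\<bar> + 1) / (1 + u \<bullet> v)"
  have "u \<bullet> (s *\<^sub>R (u + v)) = \<bar>t\<bar> + 1" "v \<bullet> (s *\<^sub>R (u + v)) = \<bar>t\<bar> + 1"
    using u v pos by (simp_all add: s_def inner_add_right inner_commute[of v u] add.commute norm_eq_1)
  then have "s *\<^sub>R (u + v) \<in> {x. t < u \<bullet> x} \<inter> {x. t < v \<bullet> x}" by auto
  then show "{x. t < u \<bullet> x} \<inter> {x. t < v \<bullet> x} \<noteq> {}" by blast
qed

lemma negligible_diff_nonempty:
  assumes "\<not> negligible A" "negligible N"
  obtains z where "z \<in> A - N"
  using assms negligible_subset by blast

text \<open>The half-spaces orthogonal to the coordinate axes cover the exterior of a ball. Two of them
  that are not opposite overlap in a set of positive measure, which transfers the oscillation bound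
  from one to the other; two opposite ones are linked by a third, and this is where
  \<open>DIM('a) \<ge> 2\<close> enters. On the line the positive and the negative half-line cannot be linked, and
  a function such as \<open>\<lambda>x. if x > 0 then 2 else 1\<close> satisfies the ball condition without having a
  limit.\<close>

lemma ess_osc_le_exterior:
  fixes p :: "'a::euclidean_space \<Rightarrow> real"
  assumes dim: "2 \<le> DIM('a)" and e: "0 \<le> e"
    and half: "\<And>u. norm u = 1 \<Longrightarrow> ess_osc_le p {x. t < u \<bullet> x} e"
  shows "ess_osc_le p {x. real DIM('a) * t < norm x} (3 * e)"
proof -
  define U where "U = Basis \<union> uminus ` (Basis :: 'a set)"
  have norm_U: "norm u = 1" if "u \<in> U" for u using that by (auto simp: U_def)
  have "\<forall>u\<in>U. \<exists>N. negligible N \<and>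
      (\<forall>x\<in>{x. t < u \<bullet> x} - N. \<forall>y\<in>{x. t < u \<bullet> x} - N. \<bar>p x - p y\<bar> \<le> e)"
    using half norm_U unfolding ess_osc_le_def by blast
  then obtain N where N: "\<And>u. u \<in> U \<Longrightarrow> negligible (N u)"
    and osc: "\<And>u x y. u \<in> U \<Longrightarrow> t < u \<bullet> x \<Longrightarrow> t < u \<bullet> y \<Longrightarrow> x \<notin> N u \<Longrightarrow> y \<notin> N u \<Longrightarrow>
      \<bar>p x - p y\<bar> \<le> e"
    unfolding bchoice_iff by auto
  define M where "M = (\<Union>u\<in>U. N u)"
  have M: "negligible M" using N unfolding M_def by (intro negligible_Union) (auto simp: U_def)
  have osc_M: "\<bar>p x - p y\<bar> \<le> e"
    if "u \<in> U" "t < u \<bullet> x" "t < u \<bullet> y" "x \<notin> M" "y \<notin> M" for u x y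
    using osc that by (auto simp: M_def)
  have link: "\<bar>p x - p y\<bar> \<le> 2 * e"
    if "u \<in> U" "v \<in> U" "v \<noteq> - u" "t < u \<bullet> x" "t < v \<bullet> y" "x \<notin> M" "y \<notin> M" for u v x y
  proof -
    have "\<not> negligible ({x. t < u \<bullet> x} \<inter> {x. t < v \<bullet> x})"
      using norm_U that by (intro not_negligible_Int_halfspaces) auto
    then obtain z where "z \<in> {x. t < u \<bullet> x} \<inter> {x. t < v \<bullet> x} - M"
      using M by (rule negligible_diff_nonempty)
    then show ?thesis using osc_M[of u x z] osc_M[of v z y] that by auto
  qed
  have cover: "\<exists>u\<in>U. t < u \<bullet> x" if "real DIM('a) * t < norm x" for x
  proof (rule ccontr)
    assume none: "\<not> ?thesis"
    have "\<bar>x \<bullet> b\<bar> \<le> t" if "b \<in> Basis" for b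
    proof -
      have "b \<in> U" "- b \<in> U" using that by (auto simp: U_def)
      then have "b \<bullet> x \<le> t" "(- b) \<bullet> x \<le> t" using none by (auto simp: not_less)
      then show ?thesis by (simp add: inner_commute abs_le_iff)
    qed
    then have "(\<Sum>b\<in>Basis. \<bar>x \<bullet> b\<bar>) \<le> real DIM('a) * t" by (rule sum_bounded_above)
    with norm_le_l1[of x] that show False by linarith
  qed
  have "\<bar>p x - p y\<bar> \<le> 3 * e"
    if x: "x \<in> {x. real DIM('a) * t < norm x} - M" and y: "y \<in> {x. real DIM('a) * t < norm x} - M"
    for x y
  proof -
    obtain u v where uv: "u \<in> U" "v \<in> U" "t < u \<bullet> x" "t < v \<bullet> y"
      using cover x y by blast
    show ?thesis
    proof (cases "v = - u")
      case False
      then show ?thesis using link[of u v x y] uv x y e by auto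
    next
      case True
      obtain b where b: "b \<in> Basis" "u = b \<or> u = - b" using uv(1) by (auto simp: U_def)
      have "\<exists>w\<in>Basis. w \<noteq> b"
      proof (rule ccontr)
        assume "\<not> ?thesis"
        then have "(Basis :: 'a set) \<subseteq> {b}" by blast
        then have "DIM('a) \<le> 1" using card_mono[of "{b}"] by fastforce
        with dim show False by simp
      qed
      then obtain w where w: "w \<in> Basis" "w \<noteq> b" by blast
      then have "w \<bullet> u = 0" "u \<bullet> u = 1" using b by (auto simp: inner_Basis)
      then have wu: "w \<noteq> u" "w \<noteq> - u" by auto
      have wU: "w \<in> U" using w by (simp add: U_def)
      have "\<not> negligible ({x. t < u \<bullet> x} \<inter> {x. t < w \<bullet> x})"
        using norm_U uv(1) wU wu by (intro not_negligible_Int_halfspaces) auto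
      then obtain z where "z \<in> {x. t < u \<bullet> x} \<inter> {x. t < w \<bullet> x} - M"
        using M by (rule negligible_diff_nonempty)
      moreover have "v \<noteq> - w" using True wu by auto
      ultimately have "\<bar>p x - p z\<bar> \<le> e" "\<bar>p z - p y\<bar> \<le> 2 * e"
        using osc_M[of u x z] link[of w v z y] uv wU x y by auto
      then show ?thesis by linarith
    qed
  qed
  with M show ?thesis unfolding ess_osc_le_def by blast
qed

text \<open>The exceptional set in \<open>ext\<close> depends on \<open>t\<close>. Restricting to rational \<open>t\<close> merges these sets
  into one null set; for a given \<open>x\<close> a rational \<open>t\<close> with \<open>D * t\<close> between \<open>norm x / 2\<close> and \<open>norm x\<close>
  then costs only a factor \<open>4\<close>.\<close>

lemma pairwise_decay_off_of_exterior:
  fixes p :: "'a::euclidean_space \<Rightarrow> real"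
  assumes D: "0 < D" and C: "0 < C"
    and ext: "\<And>t. 0 < t \<Longrightarrow> ess_osc_le p {x. D * t < norm x} (C / t\<^sup>2)"
  obtains N where "negligible N"
    "\<And>x y. x \<notin> N \<Longrightarrow> y \<notin> N \<Longrightarrow> x \<noteq> 0 \<Longrightarrow> norm x \<le> norm y \<Longrightarrow>
       \<bar>p x - p y\<bar> \<le> (4 * D\<^sup>2 * C) / (norm x)\<^sup>2"
proof -
  define T where "T = {t \<in> \<rat>. (0::real) < t}"
  have "\<forall>t\<in>T. \<exists>N. negligible N \<and> (\<forall>x\<in>{x. D * t < norm x} - N.
      \<forall>y\<in>{x. D * t < norm x} - N. \<bar>p x - p y\<bar> \<le> C / t\<^sup>2)"
    using ext unfolding ess_osc_le_def T_def by blast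
  then obtain N where N: "\<And>t. t \<in> T \<Longrightarrow> negligible (N t)"
    and osc: "\<And>t x y. t \<in> T \<Longrightarrow> D * t < norm x \<Longrightarrow> D * t < norm y \<Longrightarrow> x \<notin> N t \<Longrightarrow> y \<notin> N t \<Longrightarrow>
      \<bar>p x - p y\<bar> \<le> C / t\<^sup>2"
    unfolding bchoice_iff by auto
  show thesis
  proof
    have "countable T" unfolding T_def by (rule countable_subset[OF _ countable_rat]) auto
    then show "negligible (\<Union>t\<in>T. N t)" using N by (intro negligible_countable_Union) auto
    fix x y assume xy: "x \<notin> (\<Union>t\<in>T. N t)" "y \<notin> (\<Union>t\<in>T. N t)" "x \<noteq> 0" "norm x \<le> norm y"
    have "norm x / (2 * D) < norm x / D" using xy D by (simp add: field_simps)
    then obtain t where t: "t \<in> \<rat>" "norm x / (2 * D) < t" "t < norm x / D"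
      using Rats_dense_in_real by blast
    have x_pos: "0 < norm x / (2 * D)" using xy D by simp
    with t have "t \<in> T" by (simp add: T_def)
    moreover have "D * t < norm x" using t D by (simp add: pos_less_divide_eq mult.commute)
    ultimately have "\<bar>p x - p y\<bar> \<le> C / t\<^sup>2" using osc xy by force
    also have "\<dots> \<le> C / (norm x / (2 * D))\<^sup>2"
      using t x_pos C by (intro divide_left_mono power_mono mult_pos_pos zero_less_power) auto
    also have "\<dots> = (4 * D\<^sup>2 * C) / (norm x)\<^sup>2"
      by (simp add: power_divide power_mult_distrib)
    finally show "\<bar>p x - p y\<bar> \<le> (4 * D\<^sup>2 * C) / (norm x)\<^sup>2" .
  qed
qed

section \<open>The version with a limit at infinity\<close>

text \<open>The limit bound outside the null set \<open>N\<close> becomes a bound everywhere once \<open>p\<close> is replaced on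
  \<open>N\<close> by the limit itself; the result is again an exponent because \<open>l \<ge> 1\<close>.\<close>

lemma decay_version_of_ball_oscillation_decay:
  fixes p :: "real^'d \<Rightarrow> real"
  assumes p: "bounded_exponent p" and dim: "2 \<le> CARD('d)" and ball: "ball_oscillation_decay p"
  shows "\<exists>q. is_version_of q p \<and> decay_to_limit q"
proof -
  obtain C where C: "0 < C"
    and osc: "\<And>c r. 0 < r \<Longrightarrow> nearest_to_origin (ball c r) \<noteq> 0 \<Longrightarrow>
        ess_sup_on (ball c r) p - ess_inf_on (ball c r) p
          \<le> ereal (C / (norm (nearest_to_origin (ball c r)))\<^sup>2)"
    using ball unfolding ball_oscillation_decay_def by blast
  let ?D = "real DIM(real^'d)"
  have ext: "ess_osc_le p {x. ?D * t < norm x} ((3 * C) / t\<^sup>2)" if "0 < t" for t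
    using ess_osc_le_exterior[of "C / t\<^sup>2" p t] ess_osc_le_halfspace[OF C osc _ that] dim C
    by simp
  obtain N where N: "negligible N" and pair: "\<And>x y. x \<notin> N \<Longrightarrow> y \<notin> N \<Longrightarrow> x \<noteq> 0 \<Longrightarrow>
      norm x \<le> norm y \<Longrightarrow> \<bar>p x - p y\<bar> \<le> (4 * ?D\<^sup>2 * (3 * C)) / (norm x)\<^sup>2"
    by (rule pairwise_decay_off_of_exterior[of ?D "3 * C" p]) (use C ext in auto)
  define K where "K = 4 * ?D\<^sup>2 * (3 * C)"
  have K: "0 < K" using C by (simp add: K_def)
  have p_meas: "p \<in> borel_measurable lebesgue" and p_ge: "\<And>x. 1 \<le> p x"
    and p_bdd: "bounded (range p)"
    using p by (auto simp: bounded_exponent_def)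
  obtain l where l: "1 \<le> l" "\<And>x. x \<notin> N \<Longrightarrow> x \<noteq> 0 \<Longrightarrow> \<bar>p x - l\<bar> \<le> K / (norm x)\<^sup>2"
    using limit_of_pairwise_decay_off[OF N p_bdd p_ge pair] unfolding K_def by blast
  define q where "q x = (if x \<in> N then l else p x)" for x
  have "{x \<in> space lebesgue. x \<in> N} \<in> sets lebesgue"
    using N by (simp add: negligible_iff_null_sets null_setsD2)
  then have "q \<in> borel_measurable lebesgue"
    unfolding q_def using p_meas by (intro measurable_If) auto
  moreover have "bounded (range q)"
    by (rule bounded_subset[of "insert l (range p)"]) (use p_bdd in \<open>auto simp: q_def\<close>)
  moreover have "1 \<le> q x" for x using l p_ge by (simp add: q_def)
  moreover have "AE x in lebesgue. q x = p x"
    unfolding AE_lebesgue_iff_negligible using N by (auto simp: q_def)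
  ultimately have "is_version_of q p" by (auto simp: is_version_of_def bounded_exponent_def)
  moreover have "\<bar>q x - l\<bar> \<le> K / (norm x)\<^sup>2" if "x \<noteq> 0" for x
    using l(2)[of x] that K by (simp add: q_def)
  then have "decay_to_limit q" unfolding decay_to_limit_def using l(1) K by blast
  ultimately show ?thesis by blast
qed

theorem lemma5p12:
  fixes p :: "real ^ 'd \<Rightarrow> real"
  assumes "bounded_exponent p"
  shows "(decay_to_limit p \<longleftrightarrow> pairwise_decay p) \<and>
         (decay_to_limit p \<longrightarrow> ball_oscillation_decay p) \<and>
         (2 \<le> CARD('d) \<longrightarrow>
            (ball_oscillation_decay p \<longleftrightarrow> (\<exists>q. is_version_of q p \<and> decay_to_limit q)) \<and>
            (ball_oscillation_decay p \<longleftrightarrow> (\<exists>q. is_version_of q p \<and> pairwise_decay q)))"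
proof (intro conjI impI)
  have p_meas: "p \<in> borel_measurable lebesgue" using assms by (simp add: bounded_exponent_def)
  show "decay_to_limit p \<longleftrightarrow> pairwise_decay p"
    by (rule decay_to_limit_iff_pairwise_decay[OF assms])
  show "ball_oscillation_decay p" if "decay_to_limit p"
    by (rule ball_oscillation_decay_of_decay_version[OF p_meas that]) simp
  assume dim: "2 \<le> CARD('d)"
  show limit: "ball_oscillation_decay p \<longleftrightarrow> (\<exists>q. is_version_of q p \<and> decay_to_limit q)"
    using decay_version_of_ball_oscillation_decay[OF assms dim]
      ball_oscillation_decay_of_decay_version[OF p_meas]
    unfolding is_version_of_def by blast
  show "ball_oscillation_decay p \<longleftrightarrow> (\<exists>q. is_version_of q p \<and> pairwise_decay q)"
    unfolding limit using decay_to_limit_iff_pairwise_decay is_version_of_def by blast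
qed

end
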